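(* The ERI space $(X_0,\tau_{\mathrm{ERI}})$ is not Hausdorff: the point $\ast$ cannot be separated from any other point by disjoint open sets.
   Context: Let $\overline{\mathbb{R}}=[-\infty,+\infty]$ be the extended real line with its order topology. Let $\sim$ be the equivalence relation on $\overline{\mathbb{R}}$ whose only non-singleton class is $\{-\infty,0,+\infty\}$, let $X_0=\overline{\mathbb{R}}/{\sim}$ be the quotient set, $q\colon\overline{\mathbb{R}}\to X_0$ the projection, and $\ast=q(-\infty)=q(0)=q(+\infty)$. The ERI topology $\tau_{\mathrm{ERI}}$ on $X_0$ consists of all $U\subseteq X_0$ such that (a) $q^{-1}(U)$ is open in $\overline{\mathbb{R}}$, and (b) if $\ast\in U$ then $q^{-1}(U)$ is dense in $\overline{\mathbb{R}}$. (This is a topology.) The ERI space is $X=(X_0,\tau_{\mathrm{ERI}})$. *)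

theory Defs
  imports "HOL-Analysis.Analysis"
begin

definition eri_rel :: "(ereal \<times> ereal) set" where
  "eri_rel = {(x, y). x = y \<or> (x \<in> {-\<infinity>, 0, \<infinity>} \<and> y \<in> {-\<infinity>, 0, \<infinity>})}"

lemma equiv_eri_rel: "equiv UNIV eri_rel"
  by (rule equivI) (auto simp: eri_rel_def refl_on_def sym_def trans_def)

definition eri_carrier :: "ereal set set" where
  "eri_carrier = UNIV // eri_rel"

definition eri_proj :: "ereal \<Rightarrow> ereal set" where
  "eri_proj x = eri_rel `` {x}"

definition eri_star :: "ereal set" where
  "eri_star = eri_proj 0"

lemma eri_proj_eq_iff: "eri_proj x = eri_proj y \<longleftrightarrow> (x, y) \<in> eri_rel"
  unfolding eri_proj_def using eq_equiv_class_iff[OF equiv_eri_rel] by simp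

lemma eri_star_eq: "eri_star = eri_proj (-\<infinity>)" "eri_star = eri_proj \<infinity>"
  by (simp_all add: eri_star_def eri_proj_eq_iff eri_rel_def)

definition eri_open :: "ereal set set \<Rightarrow> bool" where
  "eri_open U \<longleftrightarrow> U \<subseteq> eri_carrier \<and> open (eri_proj -` U) \<and>
     (eri_star \<in> U \<longrightarrow> closure (eri_proj -` U) = UNIV)"

lemma istopology_eri_open: "istopology eri_open"
  unfolding istopology_def
proof (intro conjI allI impI)
  fix S T assume S: "eri_open S" and T: "eri_open T"
  have "closure (eri_proj -` (S \<inter> T)) = UNIV" if "eri_star \<in> S \<inter> T"
  proof -
    have "closure (eri_proj -` S \<inter> eri_proj -` T) = closure (eri_proj -` S \<inter> closure (eri_proj -` T))"
      using S open_Int_closure_subset[of "eri_proj -` S" "eri_proj -` T"]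
      by (intro antisym closure_minimal closure_mono)
        (auto simp: eri_open_def intro: closure_subset[THEN subsetD])
    then show ?thesis using S T that by (simp add: eri_open_def)
  qed
  with S T show "eri_open (S \<inter> T)"
    by (auto simp: eri_open_def)
next
  fix K assume K: "\<forall>U\<in>K. eri_open U"
  have "closure (eri_proj -` \<Union>K) = UNIV" if "eri_star \<in> \<Union>K"
  proof -
    from that obtain U where U: "U \<in> K" "eri_star \<in> U" by blast
    then have "closure (eri_proj -` U) \<subseteq> closure (eri_proj -` \<Union>K)"
      by (intro closure_mono) blast
    with U K show ?thesis by (auto simp: eri_open_def)
  qed
  moreover have "open (eri_proj -` \<Union>K)"
    using K by (auto simp: vimage_Union eri_open_def)
  ultimately show "eri_open (\<Union>K)"
    using K by (auto simp: eri_open_def)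
qed

definition ERI_space :: "ereal set topology" where
  "ERI_space = topology eri_open"

lemma openin_ERI_space: "openin ERI_space U \<longleftrightarrow> eri_open U"
  unfolding ERI_space_def by (simp add: istopology_eri_open topology_inverse')

lemma eri_proj_in_carrier: "eri_proj x \<in> eri_carrier"
  by (simp add: eri_proj_def eri_carrier_def quotientI)

lemma topspace_ERI_space: "topspace ERI_space = eri_carrier"
proof -
  have "eri_proj -` eri_carrier = UNIV"
    by (auto simp: eri_proj_in_carrier)
  then have "eri_open eri_carrier"
    by (simp add: eri_open_def)
  then show ?thesis
    by (auto simp: topspace_def openin_ERI_space eri_open_def)
qed

end

theory Submission
  imports Defs
begin

text \<open>By condition (b), an open set containing \<open>eri_star\<close> has dense preimage
  under \<open>eri_proj\<close>, and a dense set meets every nonempty open set. Hence every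
  neighbourhood of \<open>eri_star\<close> meets every nonempty open set
  (\<open>eri_nhds_star_meets_open\<close>), so \<open>eri_star\<close> cannot be separated from any
  point. A second point then refutes the Hausdorff property.\<close>

lemma eri_carrier_eq_range: "eri_carrier = range eri_proj"
  by (auto simp: eri_carrier_def eri_proj_def quotient_def)

lemma eri_nhds_star_meets_open:
  assumes "openin ERI_space U" "openin ERI_space V" "eri_star \<in> U" "V \<noteq> {}"
  shows "\<not> disjnt U V"
proof -
  have U: "closure (eri_proj -` U) = UNIV"
    and V: "open (eri_proj -` V)" "V \<subseteq> range eri_proj"
    using assms by (auto simp: openin_ERI_space eri_open_def eri_carrier_eq_range)
  \<comment> \<open>Surjectivity of \<open>eri_proj\<close> onto the carrier keeps the preimage of
    \<open>V\<close> nonempty.\<close>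
  have "eri_proj -` V \<noteq> {}"
    using V(2) \<open>V \<noteq> {}\<close> by auto
  \<comment> \<open>An open set that misses a set also misses its closure, which here is
    everything.\<close>
  then have "eri_proj -` V \<inter> eri_proj -` U \<noteq> {}"
    using open_Int_closure_eq_empty[OF V(1), of "eri_proj -` U"] U by simp
  then show ?thesis
    by (auto simp: disjnt_def)
qed

theorem theorem2p13:
  "\<not> Hausdorff_space ERI_space \<and>
   (\<forall>x \<in> eri_carrier - {eri_star}.
      \<not> (\<exists>U V. openin ERI_space U \<and> openin ERI_space V \<and>
               eri_star \<in> U \<and> x \<in> V \<and> disjnt U V))"
proof
  show inseparable: "\<forall>x \<in> eri_carrier - {eri_star}.
      \<not> (\<exists>U V. openin ERI_space U \<and> openin ERI_space V \<and>
               eri_star \<in> U \<and> x \<in> V \<and> disjnt U V)"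
    using eri_nhds_star_meets_open by blast
  \<comment> \<open>The class of 1 serves as the second point; any nonzero real would do.\<close>
  have "eri_proj 1 \<noteq> eri_star"
    by (simp add: eri_star_def eri_proj_eq_iff eri_rel_def)
  moreover have "eri_star \<in> eri_carrier"
    by (simp add: eri_star_def eri_proj_in_carrier)
  ultimately show "\<not> Hausdorff_space ERI_space"
    using inseparable eri_proj_in_carrier[of 1]
    unfolding Hausdorff_space_def topspace_ERI_space by (metis DiffI singletonD)
qed

end
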